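(* Let $A$ be a finite nonempty set of positive real numbers and let $k\geq 1$ be an integer. Then $$|4^{k-1}A^{(k)}|\geq |A|^k.$$
   Context: For a finite set $X$ of numbers and an integer $m\ge1$, $mX:=\{x_1+\cdots+x_m: x_1,\dots,x_m\in X\}$ is the $m$-fold sum set and $X^{(m)}:=\{x_1\cdots x_m: x_1,\dots,x_m\in X\}$ the $m$-fold product set. Thus $4^{k-1}A^{(k)}$ is the $4^{k-1}$-fold sum set of the $k$-fold product set of $A$. *)

theory Defs
  imports Main "HOL.Real"
begin

definition sumset_iter :: "nat \<Rightarrow> real set \<Rightarrow> real set" where
  "sumset_iter m X = {sum_list xs | xs. length xs = m \<and> set xs \<subseteq> X}"

definition prodset_iter :: "nat \<Rightarrow> real set \<Rightarrow> real set" where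
  "prodset_iter m X = {prod_list xs | xs. length xs = m \<and> set xs \<subseteq> X}"

end

theory Submission
  imports Defs Complex_Main
begin

text \<open>
  The statement follows by induction from the inequality \<open>|A||B| \<le> |AB + AB + AB + AB|\<close> for finite
  sets of positive reals. Following Solymosi, sums of vectors from two consecutive lines through the
  origin have slopes strictly between the two slopes, so different consecutive pairs produce
  different sums. Applied to the points of \<open>A \<times> A\<close> this shows that \<open>R = (A + A) / (A + A)\<close> has
  more than \<open>|A|\<^sup>2\<close> elements once \<open>|A| \<ge> 2\<close>. Each slope \<open>r = (a + b) / (c + d)\<close> in \<open>R\<close> carries the
  \<open>|B|\<close> points \<open>((c + d) t, (a + b) t)\<close> with \<open>t \<in> B\<close>, and adding the points of consecutive lines
  gives \<open>(|R| - 1) |B|\<^sup>2\<close> distinct points of \<open>(AB + AB + AB + AB)\<^sup>2\<close>.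
\<close>

section \<open>Consecutive elements of a finite set, and mediants\<close>

text \<open>At the maximum of \<open>S\<close> the \<open>Min\<close> is taken over the empty set
  and is unspecified, so the arguments of interest lie in \<open>S - {Max S}\<close>.\<close>

definition next_in :: "'a::linorder set \<Rightarrow> 'a \<Rightarrow> 'a" where
  "next_in S r = Min {s \<in> S. r < s}"

lemma next_in:
  assumes "finite S" "r \<in> S - {Max S}"
  shows "next_in S r \<in> S" "r < next_in S r"
proof -
  have "Max S \<in> {s \<in> S. r < s}"
    using assms by (metis (mono_tags, lifting) DiffE Max_ge Max_in empty_iff insertCI mem_Collect_eq
        order_le_less)
  then have "next_in S r \<in> {s \<in> S. r < s}"
    unfolding next_in_def using assms(1) by (intro Min_in) auto
  then show "next_in S r \<in> S" "r < next_in S r" by auto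
qed

lemma next_in_le:
  assumes "finite S" "s \<in> S" "r < s"
  shows "next_in S r \<le> s"
  unfolding next_in_def using assms by (intro Min_le) auto

text \<open>If \<open>r < s\<close>, then \<open>next_in S r \<le> s < x\<close>, a contradiction.
  This is how the slope of a sum reveals the pair of lines it came from.\<close>

lemma next_in_gap_unique:
  assumes "finite S" "r \<in> S" "s \<in> S"
    and "r < x" "x < next_in S r" "s < x" "x < next_in S s"
  shows "r = s"
proof -
  have "\<not> r < s" "\<not> s < r"
    using next_in_le[of S s r] next_in_le[of S r s] assms by auto
  then show ?thesis by simp
qed

text \<open>The quotient is the slope of \<open>(x, l * x) + (u, m * u)\<close>, an average of
  \<open>l\<close> and \<open>m\<close> with weights \<open>x\<close> and \<open>u\<close>.\<close>

lemma mediant_strict_between: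
  fixes l m x u :: real
  assumes "l < m" "x > 0" "u > 0"
  shows "l < (l * x + m * u) / (x + u)" "(l * x + m * u) / (x + u) < m"
  using assms by (simp_all add: pos_less_divide_eq pos_divide_less_eq algebra_simps)

text \<open>With \<open>u\<close> fixed, the weight of \<open>l\<close> strictly increases with
  \<open>x\<close>.\<close>

lemma mediant_inject:
  fixes l m x y u :: real
  assumes "l < m" "x > 0" "y > 0" "u > 0"
    and "(l * x + m * u) / (x + u) = (l * y + m * u) / (y + u)"
  shows "x = y"
proof -
  have "(l * x + m * u) * (y + u) = (l * y + m * u) * (x + u)"
    using assms by (simp add: frac_eq_eq)
  then have "(x - y) * u * (m - l) = 0" by algebra
  then show ?thesis using assms by simp
qed

section \<open>Quotients of sums of two elements\<close>

text \<open>Maximality closes the chain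
  \<open>Max A * x \<le> y * Min A \<le> y * x \<le> Max A * x\<close>. Hence discarding the
  steepest line through \<open>A \<times> A\<close> costs a single point.\<close>

lemma max_ratio_unique:
  fixes A :: "real set"
  assumes "finite A" "A \<noteq> {}" "\<forall>a\<in>A. a > 0"
    and "x \<in> A" "y \<in> A" "y / x = Max ((\<lambda>(x, y). y / x) ` (A \<times> A))"
  shows "x = Min A \<and> y = Max A"
proof -
  have m: "Min A \<in> A" "Max A \<in> A" "Min A \<le> x" "y \<le> Max A" using assms by auto
  have "Max A / Min A \<le> y / x"
    unfolding assms(6) using assms(1) m
    by (intro Max_ge) (auto intro!: image_eqI[of _ _ "(Min A, Max A)"])
  moreover have "Min A > 0" "x > 0" "y > 0" "Max A > 0" using assms m by auto
  ultimately have "Max A * x \<le> y * Min A" by (simp add: divide_simps mult.commute)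
  moreover have "y * Min A \<le> y * x" "y * x \<le> Max A * x"
    using m \<open>x > 0\<close> \<open>y > 0\<close> by (auto intro: mult_mono)
  ultimately have "y * Min A = y * x" "y * x = Max A * x" by linarith+
  then show ?thesis using \<open>x > 0\<close> \<open>y > 0\<close> by simp
qed

text \<open>Two disjoint families lie in \<open>R\<close>: the slopes of points of
  \<open>A \<times> A\<close>, and mediants strictly between consecutive slopes, one for each point
  off the steepest line.\<close>

lemma card_ratio_of_sums:
  fixes A R :: "real set"
  assumes A: "finite A" "\<forall>a\<in>A. a > 0" "card A \<ge> 2"
    and R: "finite R" "\<And>a b c d. \<lbrakk>a \<in> A; b \<in> A; c \<in> A; d \<in> A\<rbrakk> \<Longrightarrow> (a + b) / (c + d) \<in> R"
  shows "card A ^ 2 + 1 \<le> card R"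
proof -
  define sl where "sl = (\<lambda>(x, y). y / x :: real)"
  define L where "L = sl ` (A \<times> A)"
  define P where "P = {p \<in> A \<times> A. sl p \<noteq> Max L}"
  have ne: "A \<noteq> {}" using A(3) by auto
  have finL: "finite L" using A(1) by (simp add: L_def)
  have "\<exists>q\<in>A \<times> A. sl q = l" if "l \<in> L" for l using that by (auto simp: L_def)
  then obtain q where q: "q l \<in> A \<times> A" "sl (q l) = l" if "l \<in> L" for l by metis
  \<comment> \<open>The partner of \<open>p\<close> is one chosen point on the next line. It depends
    only on the slope of \<open>p\<close>, so points on a common line share it, as
    \<open>mediant_inject\<close> requires.\<close>
  define N where "N p = q (next_in L (sl p))" for p
  define f where "f p = (snd p + snd (N p)) / (fst p + fst (N p))" for p
  have P: "fst p \<in> A" "snd p \<in> A" "fst p > 0" "snd p = sl p * fst p" "sl p \<in> L"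
    "fst (N p) \<in> A" "snd (N p) \<in> A" "fst (N p) > 0"
    "snd (N p) = next_in L (sl p) * fst (N p)" "sl p < next_in L (sl p)" if "p \<in> P" for p
  proof -
    have p: "p \<in> A \<times> A" "sl p \<in> L - {Max L}" using that by (auto simp: P_def L_def)
    have n: "N p \<in> A \<times> A" "sl (N p) = next_in L (sl p)"
      using q next_in(1)[OF finL p(2)] by (auto simp: N_def)
    show "fst p \<in> A" "snd p \<in> A" "fst p > 0" "snd p = sl p * fst p" "sl p \<in> L"
      using p A(2) by (auto simp: sl_def)
    show "fst (N p) \<in> A" "snd (N p) \<in> A" and pos: "fst (N p) > 0" using n A(2) by auto
    show "snd (N p) = next_in L (sl p) * fst (N p)"
      unfolding n(2)[symmetric] using pos by (simp add: sl_def case_prod_unfold)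
    show "sl p < next_in L (sl p)" using next_in(2)[OF finL p(2)] .
  qed
  have f: "f p = (sl p * fst p + next_in L (sl p) * fst (N p)) / (fst p + fst (N p))"
    if "p \<in> P" for p
    unfolding f_def P(4)[OF that] P(9)[OF that] ..
  have btw: "sl p < f p" "f p < next_in L (sl p)" if "p \<in> P" for p
    unfolding f[OF that] using mediant_strict_between P[OF that] by blast+
  have inj: "inj_on f P"
  proof (rule inj_onI)
    fix p p' assume h: "p \<in> P" "p' \<in> P" "f p = f p'"
    have e: "sl p = sl p'"
      using next_in_gap_unique[OF finL P(5)[OF h(1)] P(5)[OF h(2)] btw[OF h(1)]] btw[OF h(2)] h(3)
      by simp
    then have N: "N p = N p'" by (simp add: N_def)
    have "fst p = fst p'"
      using h(3) unfolding f[OF h(1)] f[OF h(2)] e N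
      by (intro mediant_inject[OF P(10)[OF h(2)] P(3)[OF h(1)] P(3)[OF h(2)] P(8)[OF h(2)]])
    then show "p = p'" using P(4)[OF h(1)] P(4)[OF h(2)] e by (simp add: prod_eq_iff)
  qed
  have disj: "f ` P \<inter> L = {}"
  proof -
    have "f p \<notin> L" if "p \<in> P" for p
      using next_in_le[OF finL, of "f p" "sl p"] btw[OF that] by auto
    then show ?thesis by auto
  qed
  have "f ` P \<subseteq> R" using R(2) P by (auto simp: f_def)
  \<comment> \<open>A slope \<open>y / x\<close> equals \<open>(y + y) / (x + x)\<close>.\<close>
  moreover have "L \<subseteq> R"
  proof
    fix l assume "l \<in> L"
    then obtain x y where "x \<in> A" "y \<in> A" "l = y / x" by (auto simp: L_def sl_def)
    then show "l \<in> R" using R(2)[of y y x x] by (simp flip: mult_2)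
  qed
  ultimately have "card (f ` P \<union> L) \<le> card R" using R(1) by (intro card_mono) auto
  moreover have "finite P" using A(1) by (simp add: P_def)
  ultimately have le: "card P + card L \<le> card R"
    using card_Un_disjoint[OF _ finL disj] card_image[OF inj] by simp
  have "A \<times> A \<subseteq> insert (Min A, Max A) P"
    using max_ratio_unique[OF A(1) ne A(2)] by (auto simp: P_def L_def sl_def)
  then have "card (A \<times> A) \<le> card P + 1"
    using card_mono[of "insert (Min A, Max A) P"] \<open>finite P\<close> card_insert_le_m1
    by (metis Suc_eq_plus1 card_insert_if finite_insert le_Suc_eq)
  then have cP: "card A ^ 2 \<le> card P + 1" by (simp add: card_cartesian_product power2_eq_square)
  \<comment> \<open>The quotients \<open>x / Min A\<close> give at least two slopes: one makes up
    for the lost point, the other gives the surplus \<open>1\<close>.\<close>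
  have "inj_on (\<lambda>x. sl (Min A, x)) A"
    using A(2) Min_in[OF A(1) ne] by (auto simp: inj_on_def sl_def)
  then have "card A \<le> card L"
    using finL Min_in[OF A(1) ne] by (intro card_inj_on_le) (auto simp: L_def)
  then show ?thesis using le cP A(3) by linarith
qed

section \<open>The inequality for fourfold sums of products\<close>

lemma card_fourfold_sum_of_products:
  fixes A B S :: "real set"
  assumes A: "finite A" "\<forall>a\<in>A. a > 0" and B: "finite B" "\<forall>b\<in>B. b > 0"
    and S: "finite S" "\<And>a b c d x y z w. \<lbrakk>a \<in> A; b \<in> A; c \<in> A; d \<in> A; x \<in> B; y \<in> B; z \<in> B; w \<in> B\<rbrakk>
      \<Longrightarrow> a * x + b * y + c * z + d * w \<in> S"
  shows "card A * card B \<le> card S"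
proof (cases "card A \<ge> 2")
  \<comment> \<open>The count of quotients needs two elements. For a singleton \<open>A\<close>, the
    dilate of \<open>B\<close> by \<open>4 * a\<close> already lies in \<open>S\<close>.\<close>
  case False
  show ?thesis
  proof (cases "A = {}")
    case False
    then obtain a where a: "a \<in> A" by auto
    then have "inj_on (\<lambda>x. a * x + a * x + a * x + a * x) B"
      using A(2) by (auto simp: inj_on_def)
    moreover have "(\<lambda>x. a * x + a * x + a * x + a * x) ` B \<subseteq> S"
      using S(2)[OF a a a a] by blast
    ultimately have "card B \<le> card S" using S(1) by (intro card_inj_on_le)
    moreover have "card A * card B \<le> 1 * card B"
      using \<open>\<not> card A \<ge> 2\<close> by (intro mult_right_mono) auto
    ultimately show ?thesis by linarith
  qed simp
next
  case True
  define T where "T = {a + b | a b. a \<in> A \<and> b \<in> A}"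
  define R where "R = (\<lambda>(x, y). y / x) ` (T \<times> T)"
  have Tpos: "t > 0" if "t \<in> T" for t using that A(2) by (auto simp: T_def add_pos_pos)
  have "finite T" using A(1) unfolding T_def by (simp add: finite_image_set2)
  then have finR: "finite R" by (simp add: R_def)
  have "(a + b) / (c + d) \<in> R" if "a \<in> A" "b \<in> A" "c \<in> A" "d \<in> A" for a b c d
    using that by (auto simp: R_def T_def image_iff)
  then have cR: "card A ^ 2 + 1 \<le> card R"
    using A True finR by (intro card_ratio_of_sums) auto
  have "\<exists>x y. x \<in> T \<and> y \<in> T \<and> y = r * x" if "r \<in> R" for r
    using that Tpos by (force simp: R_def)
  \<comment> \<open>\<open>X r\<close> is the abscissa of a chosen point of
    \<open>T \<times> T\<close> on the line of slope \<open>r\<close>; scaling that point by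
    \<open>B\<close> keeps it on the line.\<close>
  then obtain X where X: "X r \<in> T" "r * X r \<in> T" if "r \<in> R" for r by metis
  have Xpos: "X r > 0" if "r \<in> R" for r using X(1) Tpos that by blast
  \<comment> \<open>Splitting \<open>s\<close> and \<open>t\<close> into two elements of
    \<open>A\<close> each is what produces four summands.\<close>
  have comb: "s * x + t * y \<in> S" if st: "s \<in> T" "t \<in> T" and "x \<in> B" "y \<in> B" for s t x y
  proof -
    obtain a b c d where "s = a + b" "t = c + d" "a \<in> A" "b \<in> A" "c \<in> A" "d \<in> A"
      using st unfolding T_def by blast
    then show ?thesis using S(2)[of a b c d x x y y] that by (simp add: algebra_simps)
  qed
  let ?D = "(R - {Max R}) \<times> B \<times> B"
  define n where "n = next_in R"
  define g where "g = (\<lambda>(r, x, y). (X r * x + X (n r) * y, r * X r * x + n r * X (n r) * y))"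
  have n: "n r \<in> R" "r < n r" if "r \<in> R - {Max R}" for r
    using next_in[OF finR that] by (auto simp: n_def)
  have "g ` ?D \<subseteq> S \<times> S"
    using comb X n by (auto simp: g_def)
  moreover have "inj_on g ?D"
  proof (rule inj_onI)
    fix p p' assume "p \<in> ?D" "p' \<in> ?D" "g p = g p'"
    then obtain r x y r' x' y' where p: "p = (r, x, y)" "p' = (r', x', y')"
      and r: "r \<in> R - {Max R}" "r' \<in> R - {Max R}"
      and B': "x \<in> B" "y \<in> B" "x' \<in> B" "y' \<in> B"
      and eq: "g (r, x, y) = g (r', x', y')"
      by (cases p, cases p') auto
    then have R': "r \<in> R" "r' \<in> R" by auto
    \<comment> \<open>\<open>g (r, x, y)\<close> adds a vector on the line of slope \<open>r\<close>
      to one on the next line.\<close>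
    have slope: "r < snd (g (r, x, y)) / fst (g (r, x, y))"
      "snd (g (r, x, y)) / fst (g (r, x, y)) < n r"
      if "r \<in> R - {Max R}" "x \<in> B" "y \<in> B" for r x y
      using mediant_strict_between[of r "n r" "X r * x" "X (n r) * y"] n[OF that(1)] that
        Xpos[of r] Xpos[of "n r"] B(2)
      by (auto simp: g_def mult.assoc)
    have e: "r = r'"
      using next_in_gap_unique[OF finR R', folded n_def, OF slope[OF r(1) B'(1,2)]]
        slope[OF r(2) B'(3,4)] eq by simp
    have 1: "X r * x + X (n r) * y = X r * x' + X (n r) * y'"
      and 2: "r * X r * x + n r * X (n r) * y = r * X r * x' + n r * X (n r) * y'"
      using eq e by (auto simp: g_def)
    \<comment> \<open>Vectors of different slopes are independent: subtracting \<open>n r\<close>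
      times \<open>1\<close> from \<open>2\<close> eliminates \<open>y\<close> and
      \<open>y'\<close>, subtracting \<open>r\<close> times \<open>1\<close> eliminates
      \<open>x\<close> and \<open>x'\<close>.\<close>
    have "(n r - r) * X r * (x - x') = 0" "(n r - r) * X (n r) * (y - y') = 0"
      using 1 2 by algebra+
    then show "p = p'"
      using p e n[OF r(1)] Xpos[of r] Xpos[of "n r"] R' by auto
  qed
  ultimately have "card ?D \<le> card (S \<times> S)" using S(1) by (intro card_inj_on_le) auto
  \<comment> \<open>The surplus \<open>1\<close> in \<open>cR\<close> pays for the steepest line,
    which has no successor.\<close>
  moreover have "card (R - {Max R}) \<ge> card A ^ 2"
    using cR diff_card_le_card_Diff[of "{Max R}" R] by simp
  then have "card A ^ 2 * (card B * card B) \<le> card ?D"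
    by (simp add: card_cartesian_product del: card_Diff_insert)
  ultimately have "card A ^ 2 * (card B * card B) \<le> card (S \<times> S)" by linarith
  then have "(card A * card B) ^ 2 \<le> card S ^ 2"
    by (simp add: card_cartesian_product power2_eq_square mult_ac)
  then show ?thesis by (simp add: power2_nat_le_eq_le)
qed

section \<open>Iterated sum and product sets\<close>

lemma sumset_iter_add:
  assumes "x \<in> sumset_iter m X" "y \<in> sumset_iter n X"
  shows "x + y \<in> sumset_iter (m + n) X"
proof -
  obtain xs ys where "x = sum_list xs" "length xs = m" "set xs \<subseteq> X"
    "y = sum_list ys" "length ys = n" "set ys \<subseteq> X"
    using assms by (auto simp: sumset_iter_def)
  then show ?thesis unfolding sumset_iter_def by (auto intro!: exI[of _ "xs @ ys"])
qed

text \<open>By distributivity the factor enters every summand; in the induction this turns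
  \<open>k\<close>-fold products into \<open>Suc k\<close>-fold ones.\<close>

lemma sumset_iter_mult:
  assumes "x \<in> sumset_iter m X" "\<And>x. x \<in> X \<Longrightarrow> a * x \<in> Y"
  shows "a * x \<in> sumset_iter m Y"
proof -
  obtain xs where "x = sum_list xs" "length xs = m" "set xs \<subseteq> X"
    using assms by (auto simp: sumset_iter_def)
  then show ?thesis
    unfolding sumset_iter_def using assms(2)
    by (auto intro!: exI[of _ "map ((*) a) xs"] simp: sum_list_const_mult subset_iff)
qed

lemma prodset_iter_Suc:
  assumes "a \<in> A" "x \<in> prodset_iter k A"
  shows "a * x \<in> prodset_iter (Suc k) A"
proof -
  obtain xs where "x = prod_list xs" "length xs = k" "set xs \<subseteq> A"
    using assms by (auto simp: prodset_iter_def)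
  then show ?thesis
    unfolding prodset_iter_def using assms(1) by (auto intro!: exI[of _ "a # xs"])
qed

lemma finite_sumset_iter: "finite X \<Longrightarrow> finite (sumset_iter m X)"
  using finite_lists_length_eq[of X m]
  by (auto simp: sumset_iter_def conj_commute setcompr_eq_image)

lemma finite_prodset_iter: "finite X \<Longrightarrow> finite (prodset_iter m X)"
  using finite_lists_length_eq[of X m]
  by (auto simp: prodset_iter_def conj_commute setcompr_eq_image)

lemma sumset_iter_pos:
  assumes "\<forall>x\<in>X. x > 0" "m > 0" "s \<in> sumset_iter m X"
  shows "s > 0"
proof -
  obtain xs where xs: "s = sum_list xs" "length xs = m" "set xs \<subseteq> X"
    using assms(3) by (auto simp: sumset_iter_def)
  have "xs \<noteq> [] \<Longrightarrow> set xs \<subseteq> X \<Longrightarrow> sum_list xs > 0"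
  proof (induction xs rule: list_nonempty_induct)
    case (single x)
    then show ?case using assms(1) by auto
  next
    case (cons x xs)
    then show ?case using assms(1) by (auto intro!: add_pos_pos)
  qed
  then show ?thesis using xs assms(2) by auto
qed

lemma prodset_iter_pos:
  assumes "\<forall>x\<in>X. x > 0" "p \<in> prodset_iter m X"
  shows "p > 0"
proof -
  have "set xs \<subseteq> X \<Longrightarrow> prod_list xs > 0" for xs
    using assms(1) by (induction xs) auto
  then show ?thesis using assms(2) by (auto simp: prodset_iter_def)
qed

theorem theorem3:
  fixes A :: "real set" and k :: nat
  assumes "finite A" and "A \<noteq> {}" and "\<forall>a\<in>A. a > 0" and "k \<ge> 1"
  shows "card (sumset_iter (4 ^ (k - 1)) (prodset_iter k A)) \<ge> card A ^ k"
  using \<open>k \<ge> 1\<close>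
proof (induction k rule: dec_induct)
  case base
  have "A \<subseteq> sumset_iter 1 (prodset_iter 1 A)"
  proof
    fix a assume "a \<in> A"
    then have "a \<in> prodset_iter 1 A"
      unfolding prodset_iter_def by (auto intro!: exI[of _ "[a]"])
    then show "a \<in> sumset_iter 1 (prodset_iter 1 A)"
      unfolding sumset_iter_def by (auto intro!: exI[of _ "[a]"])
  qed
  then show ?case
    using assms(1) by (simp add: card_mono finite_sumset_iter finite_prodset_iter)
next
  case (step k)
  let ?X = "sumset_iter (4 ^ (k - 1)) (prodset_iter k A)"
  let ?Y = "prodset_iter (Suc k) A"
  \<comment> \<open>With truncated subtraction this fails at \<open>k = 0\<close>, which
    \<open>1 \<le> k\<close> excludes.\<close>
  have k: "4 ^ k = 4 ^ (k - 1) + 4 ^ (k - 1) + 4 ^ (k - 1) + (4 ^ (k - 1) :: nat)"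
    using step(1) by (cases k) auto
  \<comment> \<open>The role of \<open>B\<close> is played by \<open>?X\<close>: each of the four
    terms is a sum of \<open>4 ^ (k - 1)\<close> products of length \<open>Suc k\<close>.\<close>
  have "card A * card ?X \<le> card (sumset_iter (4 ^ k) ?Y)"
  proof (rule card_fourfold_sum_of_products)
    show "\<forall>x\<in>?X. x > 0"
      using sumset_iter_pos[of "prodset_iter k A" "4 ^ (k - 1)"] prodset_iter_pos[OF assms(3)]
      by auto
    show "a * x + b * y + c * z + d * w \<in> sumset_iter (4 ^ k) ?Y"
      if "a \<in> A" "b \<in> A" "c \<in> A" "d \<in> A" "x \<in> ?X" "y \<in> ?X" "z \<in> ?X" "w \<in> ?X"
      for a b c d x y z w
      unfolding k using that by (intro sumset_iter_add sumset_iter_mult prodset_iter_Suc)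
  qed (use assms in \<open>auto intro: finite_sumset_iter finite_prodset_iter\<close>)
  moreover have "card A * card A ^ k \<le> card A * card ?X"
    using step.IH by (intro mult_left_mono) auto
  ultimately show ?case by (simp only: power_Suc diff_Suc_1)
qed

end
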